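(* If the sequence $\mathbf{P}(n\in\tau)$ is regularly varying and $\tau$ is transient, i.e. $\mathbf{P}(\tau_1=\infty)>0$, then $$\mathbf{P}(\tau_1=n)\sim\mathbf{P}(\tau_1=\infty)^2\,\mathbf{P}(n\in\tau)\qquad\text{as } n\to\infty.$$
   Context: $\tau=\{0=\tau_0,\tau_1,\tau_2,\dots\}$ is a renewal process with i.i.d. increments $\tau_i-\tau_{i-1}$ taking values in $\{1,2,3,\dots\}\cup\{\infty\}$; it is also viewed as a random subset of the nonnegative integers, so that $\{n\in\tau\}=\{\exists k\ge0:\tau_k=n\}$. A sequence $(a_n)$ of (eventually positive) reals is regularly varying with index $\rho\in\mathbb{R}$ if $a_{\lfloor\lambda n\rfloor}/a_n\to\lambda^\rho$ as $n\to\infty$ for every $\lambda>0$. *)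

theory Defs
  imports "HOL-Probability.Probability" "HOL-Library.Landau_Symbols" "HOL-Library.Extended_Nat"
begin

text \<open>
  A renewal process is given by its increments: \<open>X i\<close> is the increment from the \<open>i\<close>-th to the
  \<open>(i + 1)\<close>-st renewal time. The increments are primitive because they cannot be recovered from the
  renewal times by subtraction once a renewal time is \<open>\<infinity>\<close>.
\<close>

locale renewal_process = prob_space M for M :: "'a measure" +
  fixes X :: "nat \<Rightarrow> 'a \<Rightarrow> enat"
  assumes indep_increments: "indep_vars (\<lambda>_. count_space UNIV) X UNIV"
    and identically_distributed_increments:
      "\<And>i. distr M (count_space UNIV) (X i) = distr M (count_space UNIV) (X 0)"
    and increments_ge_1: "\<And>i \<omega>. \<omega> \<in> space M \<Longrightarrow> 1 \<le> X i \<omega>"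

definition renewal_time :: "(nat \<Rightarrow> 'a \<Rightarrow> enat) \<Rightarrow> nat \<Rightarrow> 'a \<Rightarrow> enat" where
  "renewal_time X k \<omega> = (\<Sum>i<k. X i \<omega>)"

definition renewal_set :: "(nat \<Rightarrow> 'a \<Rightarrow> enat) \<Rightarrow> 'a \<Rightarrow> nat set" where
  "renewal_set X \<omega> = {n. \<exists>k. renewal_time X k \<omega> = enat n}"

definition regularly_varying_index :: "(nat \<Rightarrow> real) \<Rightarrow> real \<Rightarrow> bool" where
  "regularly_varying_index a \<rho> \<longleftrightarrow>
     eventually (\<lambda>n. a n > 0) sequentially \<and>
     (\<forall>l::real. l > 0 \<longrightarrow> (\<lambda>n. a (nat \<lfloor>l * real n\<rfloor>) / a n) \<longlonglongrightarrow> l powr \<rho>)"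

definition regularly_varying :: "(nat \<Rightarrow> real) \<Rightarrow> bool" where
  "regularly_varying a \<longleftrightarrow> (\<exists>\<rho>. regularly_varying_index a \<rho>)"

end

theory Submission
  imports Defs "HOL-Real_Asymp.Real_Asymp"
begin

text \<open>
  Put \<open>f n = P(\<tau>\<^sub>1 = n)\<close>, \<open>u n = P(n \<in> \<tau>)\<close> and \<open>p = P(\<tau>\<^sub>1 = \<infinity>)\<close>. The renewal equation says that
  \<open>u\<close> is the inverse of \<open>\<delta> - f\<close> for convolution, where \<open>\<delta>\<close> is the unit mass at \<open>0\<close>. Here \<open>\<delta> - f\<close> is
  absolutely summable of total mass \<open>p\<close>, and transience makes \<open>u\<close> summable too. The claim is that \<open>h = f / u\<close> tends to \<open>p\<^sup>2\<close>.

  In general, deducing the size of \<open>f\<close> from that of \<open>u\<close> is a matter of Banach algebras of Wiener type.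
  Here the trivial bound \<open>f n \<le> u n\<close> already gives \<open>0 \<le> h \<le> 1\<close>, and this boundedness permits a direct argument
  (\<open>renewal_ratio_tendsto\<close>). In the sum \<open>\<Sum>i. u i * f (n - i) = u n\<close>
  the weight concentrates at the two ends. The end with \<open>n - i\<close> small contributes about \<open>(1 - p) * u n\<close>, so the
  end with \<open>i\<close> small contributes about \<open>p * u n\<close>; as \<open>u (n - i)\<close> is asymptotic to \<open>u n\<close> for fixed \<open>i\<close>, the
  convolution of \<open>u\<close> with \<open>h\<close> tends to \<open>p\<close>. Convolving a convergent sequence with the summable
  \<open>\<delta> - f\<close> multiplies its limit by \<open>p\<close>, and this recovers \<open>h\<close> with limit \<open>p\<^sup>2\<close>.

  Apart from eventual positivity, only two consequences of regular variation enter: \<open>u (n - j) / u n\<close> tends to \<open>1\<close> for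
  fixed \<open>j\<close>, and \<open>u m / u n\<close> stays bounded for \<open>n / 2 \<le> m \<le> n\<close>
  (\<open>regularly_varying_ratio_shift\<close>, \<open>regularly_varying_bounded_ratio\<close>). Both follow from the uniform
  convergence theorem for slowly varying sequences (\<open>slowly_varying_uniform_on_upper_half\<close>), applied to
  \<open>ln (u n) - \<rho> * ln n\<close>; a Baire category argument provides the uniformity.
\<close>

section \<open>Uniform convergence for slowly varying sequences\<close>

lemma floor_multiple_asymp:
  assumes "l > (0::real)"
  shows "(\<lambda>n. real (nat \<lfloor>l * real n\<rfloor>) / real n) \<longlonglongrightarrow> l" "filterlim (\<lambda>n. nat \<lfloor>l * real n\<rfloor>) at_top at_top"
  using assms by real_asymp+

text \<open>
  The convergence is assumed for each \<open>l\<close> separately, and Baire's theorem makes it uniform somewhere: the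
  sets \<open>E k\<close> of those \<open>t\<close> for which the increments at \<open>l = exp t\<close> are at most \<open>e\<close> from index \<open>k\<close> on
  cover the real line, so one of them is dense in some ball. Since \<open>\<lfloor>exp t * n\<rfloor>\<close> is right-continuous
  in \<open>t\<close>, the bound extends from a dense subset to the whole ball. Writing \<open>m\<close> as \<open>\<lfloor>l * n\<rfloor>\<close> with
  \<open>l = m / n\<close> turns uniformity in \<open>l\<close> into uniformity in the integer \<open>m\<close>.
\<close>

lemma slowly_varying_uniform_on_some_interval:
  fixes S :: "nat \<Rightarrow> real"
  assumes S: "\<And>l. l > 0 \<Longrightarrow> (\<lambda>n. S (nat \<lfloor>l * real n\<rfloor>) - S n) \<longlonglongrightarrow> 0" and "e > 0"
  obtains a b where "0 < a" "a < b"
    "\<forall>\<^sub>F n in sequentially. \<forall>m. a * real n < real m \<and> real m < b * real n \<longrightarrow> \<bar>S m - S n\<bar> \<le> e"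
proof -
  define E where "E k = {t. \<forall>n\<ge>k. \<bar>S (nat \<lfloor>exp t * real n\<rfloor>) - S n\<bar> \<le> e}" for k
  have cover: "\<exists>k. t \<in> E k" for t
  proof -
    have "\<forall>\<^sub>F n in sequentially. \<bar>S (nat \<lfloor>exp t * real n\<rfloor>) - S n\<bar> < e"
      using tendstoD[OF S[of "exp t"] \<open>e > 0\<close>] by (simp add: dist_real_def)
    then show ?thesis
      unfolding E_def eventually_sequentially by force
  qed
  have "\<exists>k. interior (closure (E k)) \<noteq> {}"
  proof (rule ccontr)
    assume "\<not> ?thesis"
    then have "UNIV \<subseteq> closure (\<Inter>(range (\<lambda>k. - closure (E k))))"
      by (intro Baire) (auto simp: closure_complement)
    then have "(\<Inter>k. - closure (E k)) \<noteq> {}"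
      by (metis closure_empty UNIV_not_empty subset_empty)
    then show False
      using cover closure_subset by blast
  qed
  then obtain k t r where "r > 0" and r: "ball t r \<subseteq> closure (E k)"
    by (metis ex_in_conv mem_interior)
  show ?thesis
  proof (rule that)
    show "0 < exp (t - r)" "exp (t - r) < exp (t + r)"
      using \<open>r > 0\<close> by auto
    have "\<bar>S m - S n\<bar> \<le> e"
      if n: "n \<ge> k" "n \<ge> 1" and m: "exp (t - r) * real n < real m" "real m < exp (t + r) * real n" for n m
    proof -
      \<comment> \<open>Every \<open>s\<close> in \<open>[x, y)\<close> gives \<open>\<lfloor>exp s * n\<rfloor> = m\<close>, and \<open>(x, y)\<close> lies in the ball, so it meets \<open>E k\<close>.\<close>
      define x where "x = ln (real m / real n)"
      define y where "y = min (t + r) (ln ((real m + 1) / real n))"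
      have "real m > 0"
        using m(1) by (meson exp_ge_zero mult_nonneg_nonneg of_nat_0_le_iff order_le_less_trans)
      have exp_x: "exp x = real m / real n" and exp_m: "exp (ln ((real m + 1) / real n)) = (real m + 1) / real n"
        using n \<open>real m > 0\<close> by (auto simp: x_def)
      have "exp (t - r) < exp x" "exp x < exp (t + r)" "exp x < exp (ln ((real m + 1) / real n))"
        unfolding exp_x exp_m using n m by (simp_all add: field_simps)
      then have "x > t - r" "x < t + r" "x < ln ((real m + 1) / real n)"
        by simp_all
      then have "x < y" by (simp add: y_def)
      have "{x<..<y} \<subseteq> ball t r"
        using \<open>x > t - r\<close> by (auto simp: y_def dist_real_def)
      then have "{x<..<y} \<inter> closure (E k) \<noteq> {}"
        using r dense[OF \<open>x < y\<close>] by fastforce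
      then obtain s where s: "x < s" "s < y" "s \<in> E k"
        using open_Int_closure_eq_empty[OF open_greaterThanLessThan, of x y "E k"] by auto
      then have "exp x \<le> exp s" "exp s < exp (ln ((real m + 1) / real n))"
        by (auto simp: y_def)
      then have "real m / real n \<le> exp s" "exp s < (real m + 1) / real n"
        unfolding exp_x exp_m by auto
      then have "nat \<lfloor>exp s * real n\<rfloor> = m"
        using n by (simp add: field_simps floor_eq_iff nat_eq_iff)
      then show ?thesis
        using s n by (auto simp: E_def)
    qed
    then show "\<forall>\<^sub>F n in sequentially. \<forall>m. exp (t - r) * real n < real m \<and> real m < exp (t + r) * real n
        \<longrightarrow> \<bar>S m - S n\<bar> \<le> e"
      unfolding eventually_sequentially by (intro exI[of _ "max k 1"]) auto
  qed
qed

text \<open>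
  Multiplication by a fixed \<open>l\<close> costs only the pointwise hypothesis, so it carries the interval of
  uniformity found by Baire's theorem to a neighbourhood of any prescribed \<open>x\<close>: compare \<open>m\<close> with
  \<open>\<lfloor>l * n\<rfloor>\<close>, where \<open>l\<close> sends the midpoint of that interval to \<open>x\<close>, and then \<open>\<lfloor>l * n\<rfloor>\<close> with \<open>n\<close>.
\<close>

lemma slowly_varying_uniform_near_point:
  fixes S :: "nat \<Rightarrow> real"
  assumes S: "\<And>l. l > 0 \<Longrightarrow> (\<lambda>n. S (nat \<lfloor>l * real n\<rfloor>) - S n) \<longlonglongrightarrow> 0" and "e > 0" "x > 0"
  obtains d where "d > 0" "\<forall>\<^sub>F n in sequentially. \<forall>m. \<bar>real m / real n - x\<bar> < d \<longrightarrow> \<bar>S m - S n\<bar> \<le> e"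
proof -
  obtain a b where ab: "0 < a" "a < b" and
    unif: "\<forall>\<^sub>F n in sequentially. \<forall>m. a * real n < real m \<and> real m < b * real n \<longrightarrow> \<bar>S m - S n\<bar> \<le> e / 2"
    by (rule slowly_varying_uniform_on_some_interval[OF S half_gt_zero[OF \<open>e > 0\<close>]])
  define l where "l = x / ((a + b) / 2)"
  have "l > 0" using ab \<open>x > 0\<close> by (simp add: l_def)
  have al: "a * l < x" "x < b * l"
    using ab \<open>x > 0\<close> by (auto simp: l_def field_simps)
  define d where "d = min (x - a * l) (b * l - x) / 2"
  have "d > 0" using al by (simp add: d_def)
  define N where "N n = nat \<lfloor>l * real n\<rfloor>" for n :: nat
  have lim: "(\<lambda>n. real (N n) / real n) \<longlonglongrightarrow> l"
    unfolding N_def using floor_multiple_asymp[OF \<open>l > 0\<close>] by simp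
  have top: "filterlim N at_top at_top"
    unfolding N_def using floor_multiple_asymp[OF \<open>l > 0\<close>] by simp
  have e1: "\<forall>\<^sub>F n in sequentially. a * (real (N n) / real n) < a * l + d"
    by (rule order_tendstoD(2)[OF tendsto_mult_left[OF lim]]) (use \<open>d > 0\<close> in auto)
  have e2: "\<forall>\<^sub>F n in sequentially. b * (real (N n) / real n) > b * l - d"
    by (rule order_tendstoD(1)[OF tendsto_mult_left[OF lim]]) (use \<open>d > 0\<close> in auto)
  have e3: "\<forall>\<^sub>F n in sequentially. \<bar>S (N n) - S n\<bar> < e / 2"
    using tendstoD[OF S[OF \<open>l > 0\<close>], of "e / 2"] \<open>e > 0\<close> by (simp add: dist_real_def N_def)
  have e4: "\<forall>\<^sub>F n in sequentially. \<forall>m. a * real (N n) < real m \<and> real m < b * real (N n) \<longrightarrow> \<bar>S m - S (N n)\<bar> \<le> e / 2"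
    using unif top by (rule eventually_compose_filterlim)
  have "\<forall>\<^sub>F n in sequentially. \<forall>m. \<bar>real m / real n - x\<bar> < d \<longrightarrow> \<bar>S m - S n\<bar> \<le> e"
    using e1 e2 e3 e4 eventually_gt_at_top[of 0]
  proof eventually_elim
    case (elim n)
    show ?case
    proof (intro allI impI)
      fix m assume m: "\<bar>real m / real n - x\<bar> < d"
      have "a * l + d \<le> x - d" "x + d \<le> b * l - d"
        by (auto simp: d_def min_def field_simps)
      then have "a * (real (N n) / real n) < real m / real n" "real m / real n < b * (real (N n) / real n)"
        using elim(1,2) m by linarith+
      then have "a * real (N n) < real m \<and> real m < b * real (N n)"
        using elim(5) by (auto simp: field_simps)
      then have "\<bar>S m - S (N n)\<bar> \<le> e / 2" using elim(4) by blast
      then show "\<bar>S m - S n\<bar> \<le> e" using elim(3) by linarith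
    qed
  qed
  then show ?thesis using that \<open>d > 0\<close> by blast
qed

text \<open>
  The uniform convergence theorem for slowly varying sequences, in additive form and on the compact
  interval \<open>[1/2, 1]\<close> of ratios \<open>m / n\<close>; finitely many of the neighbourhoods above cover it.
\<close>

lemma slowly_varying_uniform_on_upper_half:
  fixes S :: "nat \<Rightarrow> real"
  assumes S: "\<And>l. l > 0 \<Longrightarrow> (\<lambda>n. S (nat \<lfloor>l * real n\<rfloor>) - S n) \<longlonglongrightarrow> 0" and "e > 0"
  shows "\<forall>\<^sub>F n in sequentially. \<forall>m. n \<le> 2 * m \<and> m \<le> n \<longrightarrow> \<bar>S m - S n\<bar> \<le> e"
proof -
  have "\<forall>x\<in>{1/2..1::real}. \<exists>d>0. \<forall>\<^sub>F n in sequentially. \<forall>m. \<bar>real m / real n - x\<bar> < d \<longrightarrow> \<bar>S m - S n\<bar> \<le> e"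
  proof
    fix x :: real assume "x \<in> {1/2..1}"
    then have "x > 0" by simp
    show "\<exists>d>0. \<forall>\<^sub>F n in sequentially. \<forall>m. \<bar>real m / real n - x\<bar> < d \<longrightarrow> \<bar>S m - S n\<bar> \<le> e"
      by (rule slowly_varying_uniform_near_point[OF S \<open>e > 0\<close> \<open>x > 0\<close>]) blast+
  qed
  from bchoice[OF this] obtain d where d: "\<And>x::real. x \<in> {1/2..1} \<Longrightarrow> d x > 0"
     "\<And>x::real. x \<in> {1/2..1} \<Longrightarrow> \<forall>\<^sub>F n in sequentially. \<forall>m. \<bar>real m / real n - x\<bar> < d x \<longrightarrow> \<bar>S m - S n\<bar> \<le> e"
    by blast
  have "{1/2..1::real} \<subseteq> (\<Union>x\<in>{1/2..1}. ball x (d x))"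
    using d(1) by force
  then obtain D where D: "D \<subseteq> {1/2..1}" "finite D" "{1/2..1::real} \<subseteq> (\<Union>x\<in>D. ball x (d x))"
    using compactE_image[OF compact_Icc, of "{1/2..1}" "\<lambda>x. ball x (d x)"] by blast
  have "\<forall>\<^sub>F n in sequentially. \<forall>x\<in>D. \<forall>m. \<bar>real m / real n - x\<bar> < d x \<longrightarrow> \<bar>S m - S n\<bar> \<le> e"
    using D d(2) by (intro eventually_ball_finite) auto
  then show ?thesis
    using eventually_gt_at_top[of 0]
  proof eventually_elim
    case (elim n)
    show ?case
    proof (intro allI impI)
      fix m assume "n \<le> 2 * m \<and> m \<le> n"
      then have "real n \<le> 2 * real m" "real m \<le> real n"
        by linarith+
      then have "real m / real n \<in> {1/2..1}"
        using elim(2) by (auto simp: field_simps)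
      then have "real m / real n \<in> (\<Union>x\<in>D. ball x (d x))"
        using D(3) by blast
      then obtain x where "x \<in> D" "\<bar>real m / real n - x\<bar> < d x"
        by (auto simp: dist_real_def abs_minus_commute)
      then show "\<bar>S m - S n\<bar> \<le> e" using elim(1) by blast
    qed
  qed
qed

text \<open>
  Logarithms turn the ratios of regular variation into differences, and subtracting \<open>\<rho> * ln n\<close> removes the
  limit \<open>\<rho> * ln l\<close>, so that the theorem on uniformity above applies to \<open>S\<close>.
\<close>

section \<open>Ratios of regularly varying sequences\<close>

lemma regularly_varying_imp_log_slowly_varying:
  assumes "regularly_varying_index u \<rho>" "l > 0"
  defines "S \<equiv> \<lambda>n. ln (u n) - \<rho> * ln (real n)"
  shows "(\<lambda>n. S (nat \<lfloor>l * real n\<rfloor>) - S n) \<longlonglongrightarrow> 0"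
proof -
  define N where "N n = nat \<lfloor>l * real n\<rfloor>" for n :: nat
  have pos: "\<forall>\<^sub>F n in sequentially. u n > 0" and lim: "(\<lambda>n. u (N n) / u n) \<longlonglongrightarrow> l powr \<rho>"
    using assms by (auto simp: regularly_varying_index_def N_def)
  have limN: "(\<lambda>n. real (N n) / real n) \<longlonglongrightarrow> l"
    unfolding N_def using floor_multiple_asymp[OF \<open>l > 0\<close>] by simp
  have top: "filterlim N at_top at_top"
    unfolding N_def using floor_multiple_asymp[OF \<open>l > 0\<close>] by simp
  have "(\<lambda>n. ln (u (N n) / u n) - \<rho> * ln (real (N n) / real n)) \<longlonglongrightarrow> ln (l powr \<rho>) - \<rho> * ln l"
    using \<open>l > 0\<close> by (intro tendsto_intros lim limN) auto
  also have "ln (l powr \<rho>) - \<rho> * ln l = 0"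
    using \<open>l > 0\<close> by (simp add: ln_powr)
  finally show ?thesis
  proof (rule Lim_transform_eventually)
    show "\<forall>\<^sub>F n in sequentially. ln (u (N n) / u n) - \<rho> * ln (real (N n) / real n) = S (nat \<lfloor>l * real n\<rfloor>) - S n"
      using pos eventually_compose_filterlim[OF pos top] eventually_gt_at_top[of 0]
        eventually_compose_filterlim[OF eventually_gt_at_top[of 0] top]
    proof eventually_elim
      case (elim n)
      then show ?case
        by (simp add: S_def ln_div algebra_simps flip: N_def)
    qed
  qed
qed

lemma ratio_eq_powr_times_exp:
  fixes u :: "nat \<Rightarrow> real"
  assumes "u n > 0" "u m > 0" "n > 0" "m > 0"
  shows "u m / u n = (real m / real n) powr \<rho> * exp ((ln (u m) - \<rho> * ln (real m)) - (ln (u n) - \<rho> * ln (real n)))"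
proof -
  have "u m / u n = exp (ln (u m) - ln (u n))" "(real m / real n) powr \<rho> = exp (\<rho> * (ln (real m) - ln (real n)))"
    using assms by (simp_all add: powr_def exp_diff ln_div)
  then show ?thesis
    by (simp add: algebra_simps flip: exp_add)
qed

lemma regularly_varying_bounded_ratio:
  assumes "regularly_varying u"
  obtains C where "\<forall>\<^sub>F n in sequentially. \<forall>m. n \<le> 2 * m \<and> m \<le> n \<longrightarrow> u m / u n \<le> C"
proof -
  obtain \<rho> where \<rho>: "regularly_varying_index u \<rho>"
    using assms by (auto simp: regularly_varying_def)
  define S where "S = (\<lambda>n. ln (u n) - \<rho> * ln (real n))"
  have unif: "\<forall>\<^sub>F n in sequentially. \<forall>m. n \<le> 2 * m \<and> m \<le> n \<longrightarrow> \<bar>S m - S n\<bar> \<le> 1"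
    using slowly_varying_uniform_on_upper_half[of S 1] regularly_varying_imp_log_slowly_varying[OF \<rho>] unfolding S_def by simp
  have "\<forall>\<^sub>F n in sequentially. u n > 0"
    using \<rho> by (simp add: regularly_varying_index_def)
  then obtain N where N: "\<And>n. n \<ge> N \<Longrightarrow> u n > 0"
    unfolding eventually_sequentially by blast
  \<comment> \<open>The first factor bounds \<open>(m / n) powr \<rho>\<close> for either sign of \<open>\<rho>\<close>, the second the slowly varying part.\<close>
  have "\<forall>\<^sub>F n in sequentially. \<forall>m. n \<le> 2 * m \<and> m \<le> n \<longrightarrow> u m / u n \<le> 2 powr \<bar>\<rho>\<bar> * exp 1"
    using unif eventually_gt_at_top[of "2 * N"]
  proof eventually_elim
    case (elim n)
    show ?case
    proof (intro allI impI)
      fix m assume m: "n \<le> 2 * m \<and> m \<le> n"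
      have *: "n \<ge> N" "m \<ge> N" "n > 0" "m > 0" using m elim(2) by linarith+
      then have "real m / real n \<le> 1" "real n / real m \<le> 2"
        using m by (auto simp: field_simps)
      have "(real m / real n) powr \<rho> \<le> 2 powr \<bar>\<rho>\<bar>"
      proof (cases "\<rho> \<ge> 0")
        case True
        have "(real m / real n) powr \<rho> \<le> 2 powr \<rho>"
          using \<open>real m / real n \<le> 1\<close> True by (intro powr_mono2) auto
        with True show ?thesis by simp
      next
        case False
        have "(real m / real n) powr \<rho> = (real n / real m) powr (- \<rho>)"
          using * by (simp add: powr_def ln_div algebra_simps)
        also have "\<dots> \<le> 2 powr (- \<rho>)"
          using \<open>real n / real m \<le> 2\<close> False by (intro powr_mono2) auto
        finally show ?thesis using False by simp
      qed
      moreover have "exp (S m - S n) \<le> exp 1"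
        using elim(1) m by (auto dest: spec[of _ m])
      ultimately show "u m / u n \<le> 2 powr \<bar>\<rho>\<bar> * exp 1"
        unfolding S_def using ratio_eq_powr_times_exp[of u n m \<rho>] N * by (simp add: mult_mono)
    qed
  qed
  then show ?thesis using that by blast
qed

lemma regularly_varying_ratio_shift:
  assumes "regularly_varying u"
  shows "(\<lambda>n. u (n - j) / u n) \<longlonglongrightarrow> 1"
proof -
  obtain \<rho> where \<rho>: "regularly_varying_index u \<rho>"
    using assms by (auto simp: regularly_varying_def)
  define S where "S = (\<lambda>n. ln (u n) - \<rho> * ln (real n))"
  have "(\<lambda>n. S (n - j) - S n) \<longlonglongrightarrow> 0"
  proof (rule tendstoI)
    fix e :: real assume "e > 0"
    then have "\<forall>\<^sub>F n in sequentially. \<forall>m. n \<le> 2 * m \<and> m \<le> n \<longrightarrow> \<bar>S m - S n\<bar> \<le> e / 2"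
      using slowly_varying_uniform_on_upper_half[of S "e / 2"] regularly_varying_imp_log_slowly_varying[OF \<rho>] unfolding S_def by simp
    then show "\<forall>\<^sub>F n in sequentially. dist (S (n - j) - S n) 0 < e"
      using eventually_ge_at_top[of "2 * j"]
    proof eventually_elim
      case (elim n)
      then have "\<bar>S (n - j) - S n\<bar> \<le> e / 2" by auto
      then show ?case using \<open>e > 0\<close> by (simp add: dist_real_def)
    qed
  qed
  moreover have "(\<lambda>n. real (n - j) / real n) \<longlonglongrightarrow> 1"
    by real_asymp
  ultimately have "(\<lambda>n. (real (n - j) / real n) powr \<rho> * exp (S (n - j) - S n)) \<longlonglongrightarrow> 1 powr \<rho> * exp 0"
    by (intro tendsto_intros) auto
  moreover have "\<forall>\<^sub>F n in sequentially. (real (n - j) / real n) powr \<rho> * exp (S (n - j) - S n) = u (n - j) / u n"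
  proof -
    have pos: "\<forall>\<^sub>F n in sequentially. u n > 0"
      using \<rho> by (simp add: regularly_varying_index_def)
    then have "\<forall>\<^sub>F n in sequentially. u (n - j) > 0"
      by (rule eventually_compose_filterlim) (rule filterlim_minus_const_nat_at_top)
    with pos show ?thesis using eventually_gt_at_top[of j]
    proof eventually_elim
      case (elim n)
      then show ?case unfolding S_def by (subst ratio_eq_powr_times_exp[of u n "n - j" \<rho>]) auto
    qed
  qed
  ultimately show ?thesis
    by (auto intro: Lim_transform_eventually)
qed

section \<open>Inverting a defective renewal equation\<close>

text \<open>
  Tannery's theorem, with the domination required for every term of the series.
\<close>

lemma tendsto_suminf_dominated:
  fixes a :: "nat \<Rightarrow> nat \<Rightarrow> real"
  assumes "\<And>k. (\<lambda>n. a k n) \<longlonglongrightarrow> b k" and "\<forall>\<^sub>F n in sequentially. \<forall>k. \<bar>a k n\<bar> \<le> M k" and "summable M"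
  shows "(\<lambda>n. \<Sum>k. a k n) \<longlonglongrightarrow> suminf b"
proof -
  have "\<forall>\<^sub>F (k, n) in sequentially \<times>\<^sub>F sequentially. norm (a k n) \<le> M k"
    using assms(2) unfolding eventually_prod_filter
    by (intro exI[of _ "\<lambda>_. True"] exI[of _ "\<lambda>n. \<forall>k. \<bar>a k n\<bar> \<le> M k"]) auto
  from tannerys_theorem[OF assms(1) this assms(3)] show ?thesis by simp
qed

text \<open>
  Summing the renewal equation over \<open>n \<le> N\<close> bounds the partial sum \<open>U\<close> by \<open>1 + s * U\<close>, and a defective
  \<open>f\<close> has \<open>s < 1\<close>.
\<close>

lemma renewal_equation_summable:
  fixes f u :: "nat \<Rightarrow> real"
  assumes f: "\<And>n. f n \<ge> 0" "f sums s" "s < 1" and u: "\<And>n. u n \<ge> 0"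
    and ren: "\<And>n. u n = (if n = 0 then 1 else 0) + (\<Sum>j\<le>n. f j * u (n - j))"
  shows "summable u"
proof (rule summableI_nonneg_bounded[OF u])
  fix N
  define U where "U = (\<Sum>n\<le>N. u n)"
  have "U = (\<Sum>n\<le>N. (if n = 0 then 1 else 0) + (\<Sum>j\<le>n. f j * u (n - j)))"
    unfolding U_def by (rule sum.cong[OF refl ren])
  also have "\<dots> = 1 + (\<Sum>n\<le>N. \<Sum>j\<le>n. f j * u (n - j))"
    by (simp add: sum.distrib)
  also have "(\<Sum>n\<le>N. \<Sum>j\<le>n. f j * u (n - j)) = (\<Sum>(i,j)\<in>{(i,j). i + j \<le> N}. f i * u j)"
    by (simp add: sum.triangle_reindex_eq)
  also have "\<dots> \<le> (\<Sum>(i,j)\<in>{..N} \<times> {..N}. f i * u j)"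
    by (rule sum_mono2) (auto simp: f u)
  also have "\<dots> = (\<Sum>i\<le>N. f i) * U"
    by (simp add: U_def sum_product sum.cartesian_product)
  also have "\<dots> \<le> s * U"
    using f u by (intro mult_right_mono) (auto simp: sums_iff U_def intro!: sum_le_suminf sum_nonneg)
  finally have "U \<le> 1 / (1 - s)"
    using \<open>s < 1\<close> by (simp add: field_simps)
  moreover have "(\<Sum>n<N. u n) \<le> U"
    unfolding U_def by (rule sum_mono2) (auto simp: u)
  ultimately show "(\<Sum>n<N. u n) \<le> 1 / (1 - s)" by simp
qed

text \<open>
  Write \<open>u \<star> h\<close> for the convolution \<open>c\<close>. Terms of the renewal sum \<open>\<Sum>i. u i * f (n - i) / u n = 1\<close> with
  \<open>n - i \<le> n / 2\<close> involve \<open>u i\<close> with \<open>i \<ge> n / 2\<close>, which is comparable to \<open>u n\<close>, and asymptotic to it when \<open>n - i\<close>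
  is fixed; by dominated convergence they add up to nearly \<open>\<Sum>j. f j = 1 - p\<close> (this is \<open>A n\<close>). Hence the
  other half \<open>B n\<close> tends to \<open>p\<close>. In that half \<open>u n\<close> may be replaced by \<open>u (n - i)\<close>, which turns \<open>B\<close> into
  \<open>u \<star> h\<close>, up to an error with terms \<open>R\<close> that is negligible, again by dominated convergence: \<open>u\<close> is summable,
  \<open>0 \<le> h \<le> 1\<close>, and the ratios \<open>u (n - i) / u n\<close> are bounded in that half. So
  \<open>u \<star> h\<close> tends to \<open>p\<close>. The convolution inverse \<open>g = \<delta> - f\<close> of \<open>u\<close> is absolutely summable with total
  mass \<open>p\<close>, and so \<open>h = g \<star> (u \<star> h)\<close> tends to \<open>p * p\<close>.
\<close>

lemma renewal_ratio_tendsto: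
  fixes f u :: "nat \<Rightarrow> real"
  assumes f: "\<And>n. f n \<ge> 0" "f 0 = 0" "f sums (1 - p)" "p > 0" and u: "\<And>n. u n \<ge> 0"
    and ren: "\<And>n. u n = (if n = 0 then 1 else 0) + (\<Sum>j\<le>n. f j * u (n - j))"
    and rv: "regularly_varying u"
  shows "(\<lambda>n. f n / u n) \<longlonglongrightarrow> p\<^sup>2"
proof -
  define h where "h = (\<lambda>n. f n / u n)"
  define g where "g = (\<lambda>n::nat. (if n = 0 then 1 else 0) - f n)"
  define c where "c = (\<lambda>n. \<Sum>i=0..n. u i * h (n - i))"
  have "u 0 = 1" using ren[of 0] f(2) by simp
  have f_le: "f n \<le> u n" for n
  proof -
    have "f n * u (n - n) \<le> (\<Sum>j\<le>n. f j * u (n - j))"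
      by (rule member_le_sum) (auto simp: f u)
    then show ?thesis using ren[of n] \<open>u 0 = 1\<close> by (simp split: if_splits)
  qed
  have h: "0 \<le> h n" "h n \<le> 1" "h n * u n = f n" for n
    using f_le[of n] f(1)[of n] u[of n] by (auto simp: h_def divide_le_eq_1)
  have sum_u: "summable u"
    by (rule renewal_equation_summable[OF f(1,3) _ u ren]) (use f(4) in simp)
  obtain C where C: "\<forall>\<^sub>F n in sequentially. \<forall>m. n \<le> 2 * m \<and> m \<le> n \<longrightarrow> u m / u n \<le> C"
    using regularly_varying_bounded_ratio[OF rv] .
  have shift: "(\<lambda>n. u (n - j) / u n) \<longlonglongrightarrow> 1" for j
    using regularly_varying_ratio_shift[OF rv] .
  have pos: "\<forall>\<^sub>F n in sequentially. u n > 0"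
    using rv by (auto simp: regularly_varying_def regularly_varying_index_def)
  \<comment> \<open>Formal power series serve as the convolution algebra: the renewal equation reads \<open>U = 1 + F * U\<close>.\<close>
  have FU: "Abs_fps u = 1 + Abs_fps f * Abs_fps u"
  proof (rule fps_ext)
    fix n show "fps_nth (Abs_fps u) n = fps_nth (1 + Abs_fps f * Abs_fps u) n"
      using ren[of n] by (simp add: fps_mult_nth atLeast0AtMost)
  qed
  have conv: "(\<Sum>i\<le>n. u i * f (n - i)) = (\<Sum>j\<le>n. f j * u (n - j))" for n
    using arg_cong[OF mult.commute[of "Abs_fps u" "Abs_fps f"], of "\<lambda>a. fps_nth a n"]
    by (simp add: fps_mult_nth atLeast0AtMost)

  define A where "A = (\<lambda>n. \<Sum>j. if 2 * j \<le> n then f j * (u (n - j) / u n) else 0)"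
  have "A \<longlonglongrightarrow> (\<Sum>j. f j)"
    unfolding A_def
  proof (rule tendsto_suminf_dominated)
    fix j
    have "(\<lambda>n. f j * (u (n - j) / u n)) \<longlonglongrightarrow> f j * 1"
      by (intro tendsto_intros shift)
    moreover have "\<forall>\<^sub>F n in sequentially. f j * (u (n - j) / u n) = (if 2 * j \<le> n then f j * (u (n - j) / u n) else 0)"
      using eventually_ge_at_top[of "2 * j"] by eventually_elim simp
    ultimately show "(\<lambda>n. if 2 * j \<le> n then f j * (u (n - j) / u n) else 0) \<longlonglongrightarrow> f j"
      by (auto intro: Lim_transform_eventually)
  next
    show "summable (\<lambda>j. f j * \<bar>C\<bar>)"
      using f(3) by (intro summable_mult2) (auto simp: sums_iff)
    show "\<forall>\<^sub>F n in sequentially. \<forall>k. \<bar>if 2 * k \<le> n then f k * (u (n - k) / u n) else 0\<bar> \<le> f k * \<bar>C\<bar>"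
      using C
    proof eventually_elim
      case (elim n)
      show ?case
      proof
        fix k
        have "u (n - k) / u n \<le> \<bar>C\<bar>" if "2 * k \<le> n"
          using elim[rule_format, of "n - k"] that by force
        then have "f k * (u (n - k) / u n) \<le> f k * \<bar>C\<bar>" if "2 * k \<le> n"
          using that f(1) by (intro mult_left_mono) auto
        moreover have "0 \<le> f k * (u (n - k) / u n)" "0 \<le> f k * \<bar>C\<bar>"
          using f(1) u by simp_all
        ultimately show "\<bar>if 2 * k \<le> n then f k * (u (n - k) / u n) else 0\<bar> \<le> f k * \<bar>C\<bar>"
          by (cases "2 * k \<le> n") (simp_all only: if_True if_False abs_of_nonneg abs_zero)
      qed
    qed
  qed
  then have A: "A \<longlonglongrightarrow> 1 - p"
    using f(3) by (simp add: sums_iff)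

  define B where "B = (\<lambda>n. \<Sum>i=0..n. if 2 * i < n then u i * (f (n - i) / u n) else 0)"
  have "\<forall>\<^sub>F n in sequentially. 1 - A n = B n"
    using pos eventually_gt_at_top[of 0]
  proof eventually_elim
    case (elim n)
    have "A n = (\<Sum>j\<le>n. if 2 * j \<le> n then f j * (u (n - j) / u n) else 0)"
      unfolding A_def by (rule suminf_finite) auto
    also have "\<dots> = (\<Sum>j\<le>n. f j * (if 2 * j \<le> n then u (n - j) / u n else 0))"
      by (rule sum.cong) auto
    also have "\<dots> = (\<Sum>i\<le>n. f (n - i) * (if 2 * (n - i) \<le> n then u (n - (n - i)) / u n else 0))"
      by (subst sum.atLeastAtMost_rev[of _ 0 n, simplified atLeast0AtMost]) (simp only: add_0_right)
    finally have "A n + B n = (\<Sum>i\<le>n. u i * f (n - i) / u n)"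
      unfolding B_def atLeast0AtMost
      by (simp add: sum.distrib[symmetric]) (rule sum.cong, auto)
    also have "\<dots> = (\<Sum>i\<le>n. u i * f (n - i)) / u n"
      by (simp add: sum_divide_distrib)
    also have "\<dots> = 1"
      using ren[of n] elim by (simp add: conv)
    finally show ?case by simp
  qed
  then have B: "B \<longlonglongrightarrow> p"
    using Lim_transform_eventually[OF tendsto_diff[OF tendsto_const A, of 1]] by simp

  define R where "R = (\<lambda>i n. if 2 * i < n then u i * (h (n - i) * (1 - u (n - i) / u n))
                     else if i \<le> n then u i * h (n - i) else 0)"
  have "(\<lambda>n. \<Sum>i. R i n) \<longlonglongrightarrow> (\<Sum>i::nat. 0::real)"
  proof (rule tendsto_suminf_dominated)
    fix i
    have "(\<lambda>n. h (n - i) * (1 - u (n - i) / u n)) \<longlonglongrightarrow> 0"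
    proof (rule Lim_null_comparison)
      show "(\<lambda>n. \<bar>1 - u (n - i) / u n\<bar>) \<longlonglongrightarrow> 0"
        using tendsto_rabs[OF tendsto_diff[OF tendsto_const shift[of i], of 1]] by simp
      show "\<forall>\<^sub>F n in sequentially. norm (h (n - i) * (1 - u (n - i) / u n)) \<le> \<bar>1 - u (n - i) / u n\<bar>"
        using h by (auto simp: abs_mult mult_left_le_one_le)
    qed
    then have "(\<lambda>n. u i * (h (n - i) * (1 - u (n - i) / u n))) \<longlonglongrightarrow> 0"
      by (rule tendsto_mult_right_zero)
    moreover have "\<forall>\<^sub>F n in sequentially. u i * (h (n - i) * (1 - u (n - i) / u n)) = R i n"
      using eventually_gt_at_top[of "2 * i"] by eventually_elim (simp add: R_def)
    ultimately show "R i \<longlonglongrightarrow> 0"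
      by (rule Lim_transform_eventually)
  next
    show "summable (\<lambda>i. u i * (1 + \<bar>C\<bar>))"
      using sum_u by (rule summable_mult2)
    show "\<forall>\<^sub>F n in sequentially. \<forall>i. \<bar>R i n\<bar> \<le> u i * (1 + \<bar>C\<bar>)"
      using C pos
    proof eventually_elim
      case (elim n)
      show ?case
      proof
        fix i
        have "h (n - i) * \<bar>1 - u (n - i) / u n\<bar> \<le> 1 * (1 + \<bar>C\<bar>)" if "2 * i < n"
        proof (rule mult_mono)
          have "u (n - i) / u n \<le> C"
            using elim(1)[rule_format, of "n - i"] that by auto
          moreover have "0 \<le> u (n - i) / u n" using u by simp
          ultimately show "\<bar>1 - u (n - i) / u n\<bar> \<le> 1 + \<bar>C\<bar>" by linarith
        qed (use h in auto)
        moreover have "h (n - i) \<le> 1 + \<bar>C\<bar>" using h(2)[of "n - i"] by linarith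
        ultimately show "\<bar>R i n\<bar> \<le> u i * (1 + \<bar>C\<bar>)"
          unfolding R_def using h(1)[of "n - i"] u[of i]
          by (auto simp: abs_mult intro!: mult_left_mono)
      qed
    qed
  qed
  then have R: "(\<lambda>n. \<Sum>i. R i n) \<longlonglongrightarrow> 0" by simp
  have "B n + (\<Sum>i. R i n) = c n" for n
  proof -
    have "(\<Sum>i. R i n) = (\<Sum>i=0..n. R i n)"
      by (rule suminf_finite) (auto simp: R_def)
    then have "B n + (\<Sum>i. R i n) = (\<Sum>i=0..n. (if 2 * i < n then u i * (f (n - i) / u n) else 0) + R i n)"
      by (simp add: B_def sum.distrib)
    also have "\<dots> = c n"
      unfolding c_def
    proof (rule sum.cong)
      fix i assume "i \<in> {0..n}"
      then show "(if 2 * i < n then u i * (f (n - i) / u n) else 0) + R i n = u i * h (n - i)"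
        unfolding R_def by (simp add: right_diff_distrib flip: h(3))
    qed simp
    finally show ?thesis .
  qed
  then have c: "c \<longlonglongrightarrow> p"
    using tendsto_add[OF B R] by simp

  have "h = (\<lambda>n. \<Sum>j. if j \<le> n then g j * c (n - j) else 0)"
  proof (rule ext)
    fix n
    have "Abs_fps g = 1 - Abs_fps f"
      by (rule fps_ext) (simp add: g_def)
    moreover have "Abs_fps u - Abs_fps f * Abs_fps u = 1"
      using FU by (metis add_diff_cancel_right')
    ultimately have "Abs_fps g * Abs_fps u = 1"
      by (simp add: left_diff_distrib)
    moreover have "Abs_fps c = Abs_fps u * Abs_fps h"
      by (rule fps_ext) (simp add: c_def fps_mult_nth)
    ultimately have "Abs_fps h = Abs_fps g * Abs_fps c"
      by (simp flip: mult.assoc)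
    then have "h n = fps_nth (Abs_fps g * Abs_fps c) n"
      by (metis fps_nth_Abs_fps)
    also have "\<dots> = (\<Sum>j=0..n. if j \<le> n then g j * c (n - j) else 0)"
      by (simp add: fps_mult_nth)
    also have "\<dots> = (\<Sum>j. if j \<le> n then g j * c (n - j) else 0)"
      by (rule suminf_finite[symmetric]) auto
    finally show "h n = (\<Sum>j. if j \<le> n then g j * c (n - j) else 0)" .
  qed
  moreover have "(\<lambda>n. \<Sum>j. if j \<le> n then g j * c (n - j) else 0) \<longlonglongrightarrow> (\<Sum>j. g j * p)"
  proof -
    obtain K where K: "\<And>n. \<bar>c n\<bar> \<le> K"
      using convergent_imp_Bseq[OF convergentI[OF c]] by (auto simp: Bseq_def)
    show ?thesis
    proof (rule tendsto_suminf_dominated)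
      fix j
      have "(\<lambda>n. g j * c (n - j)) \<longlonglongrightarrow> g j * p"
        by (intro tendsto_intros filterlim_compose[OF c] filterlim_minus_const_nat_at_top)
      moreover have "\<forall>\<^sub>F n in sequentially. g j * c (n - j) = (if j \<le> n then g j * c (n - j) else 0)"
        using eventually_ge_at_top[of j] by eventually_elim simp
      ultimately show "(\<lambda>n. if j \<le> n then g j * c (n - j) else 0) \<longlonglongrightarrow> g j * p"
        by (rule Lim_transform_eventually)
    next
      have "summable (\<lambda>j. (if j = 0 then 1 else 0) + f j)"
        using f(3) by (intro summable_add) (auto simp: sums_iff)
      moreover have "\<bar>g j\<bar> \<le> (if j = 0 then 1 else 0) + f j" for j
        using f(1)[of j] f(2) by (simp add: g_def)
      ultimately have "summable (\<lambda>j. \<bar>g j\<bar>)"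
        by (auto intro: summable_comparison_test')
      then show "summable (\<lambda>j. \<bar>g j\<bar> * K)" by (rule summable_mult2)
      show "\<forall>\<^sub>F n in sequentially. \<forall>j. \<bar>if j \<le> n then g j * c (n - j) else 0\<bar> \<le> \<bar>g j\<bar> * K"
        using K order_trans[OF abs_ge_zero K[of 0]]
        by (intro always_eventually) (auto simp: abs_mult intro!: mult_left_mono)
    qed
  qed
  moreover have "(\<Sum>j. g j * p) = p\<^sup>2"
  proof -
    have "g sums (1 - (1 - p))"
      unfolding g_def using f(3) sums_single[of 0 "\<lambda>_. 1::real"] by (intro sums_diff) auto
    from sums_mult2[OF this, of p] show ?thesis
      by (simp add: sums_iff power2_eq_square)
  qed
  ultimately have "h \<longlonglongrightarrow> p\<^sup>2"
    by simp
  then show ?thesis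
    by (simp only: h_def)
qed

section \<open>The renewal equation of a renewal process\<close>

context renewal_process
begin

lemma measurable_increment [measurable]: "X i \<in> measurable M (count_space UNIV)"
  using indep_increments by (auto simp: indep_vars_def)

lemma measurable_renewal_time [measurable]: "renewal_time X k \<in> measurable M (count_space UNIV)"
proof -
  have "(\<lambda>\<omega>. \<Sum>i<k. X i \<omega>) \<in> measurable M (count_space UNIV)"
  proof (induction k)
    case (Suc k)
    have "(\<lambda>\<omega>. (\<lambda>x \<omega>. x + X k \<omega>) (\<Sum>i<k. X i \<omega>) \<omega>) \<in> measurable M (count_space UNIV)"
      by (rule measurable_compose_countable[OF _ Suc]) measurable
    then show ?case by simp
  qed simp
  then show ?thesis by (simp add: renewal_time_def[abs_def])
qed

lemma prob_increment: "prob {\<omega>\<in>space M. X k \<omega> = x} = prob {\<omega>\<in>space M. renewal_time X 1 \<omega> = x}"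
proof -
  have "prob (X i -` {x} \<inter> space M) = measure (distr M (count_space UNIV) (X i)) {x}" for i
    by (simp add: measure_distr)
  then have "prob (X k -` {x} \<inter> space M) = prob (X 0 -` {x} \<inter> space M)"
    using identically_distributed_increments[of k] by simp
  then show ?thesis
    by (simp add: renewal_time_def vimage_def Int_def conj_commute)
qed

lemma renewal_time_add:
  assumes "\<omega> \<in> space M" shows "renewal_time X k \<omega> + enat d \<le> renewal_time X (k + d) \<omega>"
proof (induction d)
  case (Suc d)
  have "renewal_time X k \<omega> + enat d + 1 \<le> renewal_time X (k + d) \<omega> + X (k + d) \<omega>"
    using Suc increments_ge_1[OF assms] by (rule add_mono)
  then show ?case by (simp add: renewal_time_def one_enat_def add.assoc)
qed (simp flip: zero_enat_def)

lemma renewal_time_ge: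
  assumes "\<omega> \<in> space M" shows "enat k \<le> renewal_time X k \<omega>"
  using renewal_time_add[OF assms, of 0 k] by (simp add: renewal_time_def)

lemma renewal_time_inj:
  assumes "\<omega> \<in> space M" "renewal_time X k \<omega> = enat n" "renewal_time X l \<omega> = enat n"
  shows "k = l"
proof -
  have False if "k < l" "renewal_time X k \<omega> = enat n" "renewal_time X l \<omega> = enat n" for k l
    using renewal_time_add[OF assms(1), of k "l - k"] that by simp
  then show ?thesis using assms(2,3) by (metis nat_neq_iff)
qed

text \<open>
  The \<open>k\<close>-th renewal time is a function of the first \<open>k\<close> increments, so it is independent of the next
  one; decompose according to the value \<open>j\<close> of that increment.
\<close>

lemma prob_renewal_time_Suc:
  "prob {\<omega>\<in>space M. renewal_time X (Suc k) \<omega> = enat n} =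
     (\<Sum>j\<le>n. prob {\<omega>\<in>space M. renewal_time X 1 \<omega> = enat j} * prob {\<omega>\<in>space M. renewal_time X k \<omega> = enat (n - j)})"
proof -
  let ?N = "count_space UNIV :: enat measure"
  have meas_sum: "(\<lambda>f. \<Sum>i\<in>I. f i) \<in> measurable (PiM J (\<lambda>_. ?N)) ?N" if "finite I" "I \<subseteq> J" for I J :: "nat set"
    using that
  proof (induction I)
    case (insert a I)
    have IH: "(\<lambda>f. \<Sum>i\<in>I. f i) \<in> measurable (PiM J (\<lambda>_. ?N)) ?N"
      using insert by simp
    \<comment> \<open>\<open>enat\<close> is countable, so a sum is measurable as soon as it is for each fixed value of one summand.\<close>
    have "(\<lambda>f. (\<lambda>x f. f a + x) (\<Sum>i\<in>I. f i) f) \<in> measurable (PiM J (\<lambda>_. ?N)) ?N"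
    proof (rule measurable_compose_countable[OF _ IH])
      fix x :: enat
      have "(\<lambda>f. f a) \<in> measurable (PiM J (\<lambda>_. ?N)) ?N"
        using insert.prems by (intro measurable_component_singleton) auto
      then show "(\<lambda>f. f a + x) \<in> measurable (PiM J (\<lambda>_. ?N)) ?N"
        by (rule measurable_compose[where g = "\<lambda>y. y + x"]) simp
    qed
    then show ?case using insert by simp
  qed simp
  have "indep_var ?N ((\<lambda>f. \<Sum>i\<in>{k}. f i) \<circ> (\<lambda>\<omega>. restrict (\<lambda>i. X i \<omega>) {k}))
      ?N ((\<lambda>f. \<Sum>i\<in>{..<k}. f i) \<circ> (\<lambda>\<omega>. restrict (\<lambda>i. X i \<omega>) {..<k}))"
    by (intro indep_var_compose[OF indep_var_restrict[OF indep_increments]] meas_sum) auto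
  also have "(\<lambda>f. \<Sum>i\<in>{k}. f i) \<circ> (\<lambda>\<omega>. restrict (\<lambda>i. X i \<omega>) {k}) = X k"
    by auto
  also have "(\<lambda>f. \<Sum>i\<in>{..<k}. f i) \<circ> (\<lambda>\<omega>. restrict (\<lambda>i. X i \<omega>) {..<k}) = renewal_time X k"
    by (simp add: fun_eq_iff renewal_time_def)
  finally have indep: "indep_var ?N (X k) ?N (renewal_time X k)" .
  have joint: "prob {\<omega>\<in>space M. X k \<omega> = a \<and> renewal_time X k \<omega> = b} =
      prob {\<omega>\<in>space M. renewal_time X 1 \<omega> = a} * prob {\<omega>\<in>space M. renewal_time X k \<omega> = b}" for a b
    using indep_varD[OF indep, of "{a}" "{b}"] prob_increment[of k a]
    by (simp add: vimage_def Int_def conj_commute)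
  have "{\<omega>\<in>space M. renewal_time X (Suc k) \<omega> = enat n} =
      (\<Union>j\<le>n. {\<omega>\<in>space M. X k \<omega> = enat j \<and> renewal_time X k \<omega> = enat (n - j)})"
  proof -
    have "(\<exists>j\<le>n. b = enat j \<and> a = enat (n - j)) \<longleftrightarrow> a + b = enat n" for a b
      by (cases a; cases b) auto
    then show ?thesis
      by (auto simp: renewal_time_def Bex_def)
  qed
  also have "prob \<dots> = (\<Sum>j\<le>n. prob {\<omega>\<in>space M. X k \<omega> = enat j \<and> renewal_time X k \<omega> = enat (n - j)})"
    by (intro finite_measure_finite_Union) (auto simp: disjoint_family_on_def)
  finally show ?thesis by (simp add: joint)
qed

text \<open>
  A given \<open>n\<close> is hit at most once, because renewal times increase strictly while finite, and only by
  a renewal of index at most \<open>n\<close>, because each increment is at least 1. The bound \<open>K\<close> is left free so that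
  one range of summation can serve all \<open>n - j\<close> at once in the renewal equation.
\<close>

lemma prob_renewal_set:
  assumes "n \<le> K"
  shows "prob {\<omega>\<in>space M. n \<in> renewal_set X \<omega>} = (\<Sum>k\<le>K. prob {\<omega>\<in>space M. renewal_time X k \<omega> = enat n})"
proof -
  have "{\<omega>\<in>space M. n \<in> renewal_set X \<omega>} = (\<Union>k\<le>K. {\<omega>\<in>space M. renewal_time X k \<omega> = enat n})"
  proof (intro set_eqI iffI)
    fix \<omega> assume "\<omega> \<in> {\<omega>\<in>space M. n \<in> renewal_set X \<omega>}"
    then obtain k where k: "\<omega> \<in> space M" "renewal_time X k \<omega> = enat n"
      by (auto simp: renewal_set_def)
    then have "k \<le> K"
      using renewal_time_ge[of \<omega> k] assms by simp
    with k show "\<omega> \<in> (\<Union>k\<le>K. {\<omega>\<in>space M. renewal_time X k \<omega> = enat n})" by blast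
  qed (auto simp: renewal_set_def)
  also have "prob \<dots> = (\<Sum>k\<le>K. prob {\<omega>\<in>space M. renewal_time X k \<omega> = enat n})"
    by (intro finite_measure_finite_Union) (auto simp: disjoint_family_on_def dest: renewal_time_inj)
  finally show ?thesis .
qed

lemma prob_renewal_time_1_0: "prob {\<omega>\<in>space M. renewal_time X 1 \<omega> = enat 0} = 0"
proof -
  have "{\<omega>\<in>space M. renewal_time X 1 \<omega> = enat 0} = {}"
    using renewal_time_ge[of _ 1] by force
  then show ?thesis by (simp only: measure_empty)
qed

lemma renewal_equation:
  "prob {\<omega>\<in>space M. n \<in> renewal_set X \<omega>} = (if n = 0 then 1 else 0) +
     (\<Sum>j\<le>n. prob {\<omega>\<in>space M. renewal_time X 1 \<omega> = enat j} * prob {\<omega>\<in>space M. n - j \<in> renewal_set X \<omega>})"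
    (is "?u n = ?d + (\<Sum>j\<le>n. ?f j * ?u (n - j))")
proof -
  let ?T = "\<lambda>k n. prob {\<omega>\<in>space M. renewal_time X k \<omega> = enat n}"
  have "?u n = (\<Sum>k\<le>Suc n. ?T k n)"
    by (rule prob_renewal_set) simp
  also have "\<dots> = ?T 0 n + (\<Sum>k\<le>n. ?T (Suc k) n)"
    by (rule sum.atMost_Suc_shift)
  also have "?T 0 n = ?d"
    by (auto simp: renewal_time_def zero_enat_def prob_space)
  also have "(\<Sum>k\<le>n. ?T (Suc k) n) = (\<Sum>j\<le>n. ?f j * (\<Sum>k\<le>n. ?T k (n - j)))"
    unfolding prob_renewal_time_Suc sum_distrib_left by (rule sum.swap)
  also have "\<dots> = (\<Sum>j\<le>n. ?f j * ?u (n - j))"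
    by (simp add: prob_renewal_set[of "n - _" n])
  finally show ?thesis .
qed

lemma prob_renewal_time_sums:
  "(\<lambda>n. prob {\<omega>\<in>space M. renewal_time X k \<omega> = enat n}) sums (1 - prob {\<omega>\<in>space M. renewal_time X k \<omega> = \<infinity>})"
proof -
  have "(\<lambda>n. prob {\<omega>\<in>space M. renewal_time X k \<omega> = enat n}) sums prob (\<Union>n. {\<omega>\<in>space M. renewal_time X k \<omega> = enat n})"
    by (intro finite_measure_UNION) (auto simp: disjoint_family_on_def)
  also have "(\<Union>n. {\<omega>\<in>space M. renewal_time X k \<omega> = enat n}) = {\<omega>\<in>space M. \<not> renewal_time X k \<omega> = \<infinity>}"
    by (auto simp: not_infinity_eq)
  also have "prob \<dots> = 1 - prob {\<omega>\<in>space M. renewal_time X k \<omega> = \<infinity>}"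
    by (rule prob_neg) measurable
  finally show ?thesis .
qed

end

section \<open>Local asymptotics of the first renewal time\<close>

theorem theorem1p4:
  fixes M :: "'a measure" and X :: "nat \<Rightarrow> 'a \<Rightarrow> enat"
  assumes "renewal_process M X"
    and "regularly_varying (\<lambda>n. measure M {\<omega> \<in> space M. n \<in> renewal_set X \<omega>})"
    and "measure M {\<omega> \<in> space M. renewal_time X 1 \<omega> = \<infinity>} > 0"
  shows "(\<lambda>n. measure M {\<omega> \<in> space M. renewal_time X 1 \<omega> = enat n})
           \<sim>[at_top] (\<lambda>n. (measure M {\<omega> \<in> space M. renewal_time X 1 \<omega> = \<infinity>})\<^sup>2
                            * measure M {\<omega> \<in> space M. n \<in> renewal_set X \<omega>})"
proof -
  interpret renewal_process M X by fact
  define f where "f = (\<lambda>n. prob {\<omega> \<in> space M. renewal_time X 1 \<omega> = enat n})"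
  define u where "u = (\<lambda>n. prob {\<omega> \<in> space M. n \<in> renewal_set X \<omega>})"
  define p where "p = prob {\<omega> \<in> space M. renewal_time X 1 \<omega> = \<infinity>}"
  have "p > 0" using assms(3) by (simp add: p_def)
  have lim: "(\<lambda>n. f n / u n) \<longlonglongrightarrow> p\<^sup>2"
  proof (rule renewal_ratio_tendsto)
    show "f sums (1 - p)"
      unfolding f_def p_def by (rule prob_renewal_time_sums)
    show "u n = (if n = 0 then 1 else 0) + (\<Sum>j\<le>n. f j * u (n - j))" for n
      unfolding u_def f_def by (rule renewal_equation)
    show "f 0 = 0"
      unfolding f_def by (rule prob_renewal_time_1_0)
    show "regularly_varying u"
      unfolding u_def by (rule assms(2))
  qed (use \<open>p > 0\<close> in \<open>simp_all add: f_def u_def\<close>)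
  have "(\<lambda>n. f n / u n / p\<^sup>2) \<longlonglongrightarrow> p\<^sup>2 / p\<^sup>2"
    using \<open>p > 0\<close> by (intro tendsto_divide lim tendsto_const) auto
  then have "(\<lambda>n. f n / (p\<^sup>2 * u n)) \<longlonglongrightarrow> 1"
    using \<open>p > 0\<close> by (simp add: field_simps)
  then have "f \<sim>[at_top] (\<lambda>n. p\<^sup>2 * u n)"
    by (rule asymp_equivI')
  then show ?thesis
    by (simp add: f_def u_def p_def)
qed

end
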